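(* For each even integer $n\ge8$ there are unique numbers $0<r_n<1<r_n'$ such that, for $r>0$, $$\Big(1+\frac rn\Big)^{\frac n2}<\frac{1}{\sqrt e}\sum_{i=0}^{\frac n2-1}\frac{(1+r)^i}{2^i\,i!}\iff r_n<r<r_n'.$$ As the even integer $n$ increases, $$\lim_{n\to\infty}r_n=0,\qquad\lim_{n\to\infty}r_n'=\infty.$$
   Context: Multiplying both sides by $e^{-r/2}$ with $r=t/\|A\|$ gives, respectively, the upper bounds $\big(1+\frac{t}{n\|A\|}\big)^{n/2}e^{-t/(2\|A\|)}$ ($m_\infty$ bound) and $1-F_{\chi^2_n}(1+t/\|A\|)$ (weak $\chi^2$ bound) on $\Pr(\underline{\boldsymbol{x}}^{\mathsf T}A\underline{\boldsymbol{x}}-\mathrm{tr}(A)>t)$ for $A$ positive-definite $n\times n$ and $\underline{\boldsymbol{x}}\sim N(\underline 0,I_n)$. *)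

theory Defs
  imports Complex_Main
begin

text \<open>For even \<open>n \<ge> 8\<close>, \<open>thresholds n a b\<close> says that \<open>a\<close> and \<open>b\<close> can serve as the
  numbers \<open>r\<^sub>n\<close> and \<open>r'\<^sub>n\<close>; the exponent \<open>n div 2\<close> is only meant for even \<open>n\<close>.\<close>

definition thresholds :: "nat \<Rightarrow> real \<Rightarrow> real \<Rightarrow> bool" where
  "thresholds n a b \<longleftrightarrow>
     0 < a \<and> a < 1 \<and> 1 < b \<and>
     (\<forall>r>0. (1 + r / real n) ^ (n div 2)
              < 1 / sqrt (exp 1) * (\<Sum>i = 0..n div 2 - 1. (1 + r) ^ i / (2 ^ i * fact i))
            \<longleftrightarrow> a < r \<and> r < b)"

end

theory Submission
  imports Defs "HOL-Analysis.Complex_Transcendental"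
begin

text \<open>
  Put \<open>k = n / 2\<close> and \<open>s = r / 2\<close>. The difference of the two sides becomes the polynomial
  \<open>gap k s = (1 + s / k) ^ k - exp (-1/2) * T (1/2 + s)\<close>, where \<open>T\<close> (formally \<open>exp_trunc k\<close>) is
  the sum of the first \<open>k\<close> terms of the exponential series, and the claim is that, for
  \<open>s > 0\<close>, \<open>gap k s\<close> is negative exactly on a bounded open interval around \<open>1/2\<close> whose left end
  point is positive.

  Up to a factor \<open>1 / j!\<close>, the coefficient of \<open>s ^ j\<close> in \<open>gap k s\<close> compares
  \<open>k (k - 1) \<dots> (k - j + 1) / k ^ j\<close> with a partial sum of the series of \<open>exp (1/2)\<close>, divided by
  \<open>exp (1/2)\<close>. For \<open>j \<le> 1\<close> the first quantity is \<open>1\<close> and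
  wins; for \<open>2 \<le> j < k\<close> it has dropped by so much that it loses; at \<open>j = k\<close> the partial sum is
  empty and it wins again (\<open>gap_coeff_signs\<close>). Thus the coefficient signs are
  \<open>+ + - \<dots> - +\<close>, with two changes. As Descartes' rule suggests, such a polynomial is negative on
  an interval of the positive axis; \<open>two_sign_changes_neg_between\<close> proves this directly, in the
  form that negativity at two points passes to all points between them.

  It remains to locate the interval. The value at \<open>0\<close> is positive because the exponential series
  has been cut off, the value at \<open>1/2\<close> is negative (\<open>gap_half_neg\<close>), and for large \<open>s\<close> the leading
  term makes the polynomial nonnegative; the intermediate value theorem gives the two thresholds.
  For the limits, fix \<open>s > 0\<close>. Both sides tend to \<open>exp s\<close> as \<open>k\<close> grows, but the left side falls
  short of it by a relative error of order \<open>1 / k\<close> while the relative error of the right side is at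
  most \<open>(1/2 + s) ^ k / k!\<close>. Hence \<open>gap k s < 0\<close> eventually (\<open>gap_eventually_neg\<close>), so that every
  fixed \<open>r > 0\<close> eventually lies between the thresholds.
\<close>

section \<open>Polynomials whose coefficients change sign twice\<close>

lemma exp_combination_convex:
  fixes l m a b :: real
  assumes "0 \<le> l" "0 \<le> m"
  shows "convex_on UNIV (\<lambda>t. l * exp (t * a) + m * exp (t * b))"
proof (rule f''_ge0_imp_convex[where f' = "\<lambda>t. l * (a * exp (t * a)) + m * (b * exp (t * b))"
      and f'' = "\<lambda>t. l * (a\<^sup>2 * exp (t * a)) + m * (b\<^sup>2 * exp (t * b))"])
  show "((\<lambda>t. l * exp (t * a) + m * exp (t * b)) has_real_derivative
      l * (a * exp (t * a)) + m * (b * exp (t * b))) (at t)" for t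
    by (auto intro!: derivative_eq_intros)
  show "((\<lambda>t. l * (a * exp (t * a)) + m * (b * exp (t * b))) has_real_derivative
      l * (a\<^sup>2 * exp (t * a)) + m * (b\<^sup>2 * exp (t * b))) (at t)" for t
    by (auto intro!: derivative_eq_intros simp: power2_eq_square)
qed (use assms in auto)

lemma convex_on_chord:
  fixes g :: "real \<Rightarrow> real"
  assumes g: "convex_on UNIV g" and pq: "p < q" and gp: "g p = c" and gq: "g q = c"
  shows "p \<le> t \<Longrightarrow> t \<le> q \<Longrightarrow> g t \<le> c"
    and "t \<le> p \<Longrightarrow> c \<le> g t"
    and "q \<le> t \<Longrightarrow> c \<le> g t"
proof -
  have g_on: "convex_on {x..y} g" for x y
    using convex_on_subset[OF g] by blast
  show "g t \<le> c" if "p \<le> t" "t \<le> q"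
    using convex_onD_Icc'[OF g_on, of t p q] that gp gq by simp
  show "c \<le> g t" if "t \<le> p"
  proof (cases "t = p")
    case False
    define w where "w = (p - t) / (q - t)"
    have "w < 1" using that pq by (simp add: w_def)
    have "g p \<le> (g q - g t) / (q - t) * (p - t) + g t"
      using convex_onD_Icc'[OF g_on, of p t q] that pq by simp
    hence "c \<le> (c - g t) * w + g t" by (simp add: gp gq w_def)
    hence "0 \<le> (1 - w) * (g t - c)" by (simp add: algebra_simps)
    thus ?thesis using \<open>w < 1\<close> by (simp add: zero_le_mult_iff)
  qed (simp add: gp)
  show "c \<le> g t" if "q \<le> t"
  proof (cases "t = q")
    case False
    define w where "w = (t - q) / (t - p)"
    have "w < 1" using that pq by (simp add: w_def)
    have "g q \<le> (g p - g t) / (t - p) * (t - q) + g t"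
      using convex_onD_Icc''[OF g_on, of q p t] that pq by simp
    hence "c \<le> (c - g t) * w + g t" by (simp add: gp gq w_def)
    hence "0 \<le> (1 - w) * (g t - c)" by (simp add: algebra_simps)
    thus ?thesis using \<open>w < 1\<close> by (simp add: zero_le_mult_iff)
  qed (simp add: gq)
qed

text \<open>
  The weights are chosen to make \<open>l * u ^ j + m * v ^ j\<close> equal to \<open>1\<close> at \<open>j = p\<close> and \<open>j = q\<close>. As
  a function of real \<open>j\<close> the expression is convex, so it lies below \<open>1\<close> between these
  two exponents and above \<open>1\<close> outside them.
\<close>

lemma power_interpolation:
  fixes u v :: real and p q :: nat
  assumes u: "0 < u" "u < 1" and v: "1 < v" and pq: "p < q"
  obtains l m where "0 < l" "0 < m"
    "\<And>j. p \<le> j \<Longrightarrow> j \<le> q \<Longrightarrow> l * u ^ j + m * v ^ j \<le> 1"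
    "\<And>j. j \<le> p \<Longrightarrow> 1 \<le> l * u ^ j + m * v ^ j"
    "\<And>j. q \<le> j \<Longrightarrow> 1 \<le> l * u ^ j + m * v ^ j"
proof -
  define D where "D = u ^ p * v ^ q - u ^ q * v ^ p"
  have up: "u ^ q < u ^ p" using u pq by (intro power_strict_decreasing) auto
  have vp: "v ^ p < v ^ q" using v pq by (intro power_strict_increasing) auto
  have "u ^ q * v ^ p < u ^ p * v ^ q"
    using up vp u v by (intro mult_strict_mono) auto
  hence D: "D > 0" by (simp add: D_def)
  define l where "l = (v ^ q - v ^ p) / D"
  define m where "m = (u ^ p - u ^ q) / D"
  have lm: "l > 0" "m > 0" using D up vp by (auto simp: l_def m_def)
  define g where "g = (\<lambda>t. l * exp (t * ln u) + m * exp (t * ln v))"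
  have g_nat: "g (real j) = l * u ^ j + m * v ^ j" for j
    using u v by (simp add: g_def exp_of_nat_mult)
  have "l * u ^ p + m * v ^ p = D / D" "l * u ^ q + m * v ^ q = D / D"
    unfolding l_def m_def times_divide_eq_left add_divide_distrib[symmetric]
    by (simp_all add: D_def algebra_simps)
  hence gpq: "g (real p) = 1" "g (real q) = 1" using D g_nat by simp_all
  have "convex_on UNIV g" unfolding g_def using lm by (intro exp_combination_convex) auto
  from convex_on_chord[OF this _ gpq] pq have chord:
    "real p \<le> t \<Longrightarrow> t \<le> real q \<Longrightarrow> g t \<le> 1" "t \<le> real p \<Longrightarrow> 1 \<le> g t" "real q \<le> t \<Longrightarrow> 1 \<le> g t" for t
    by auto
  show ?thesis
    using that[of l m] lm chord g_nat by (metis of_nat_le_iff)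
qed

text \<open>
  A variation-diminishing argument: with \<open>l\<close> and \<open>m\<close> from \<open>power_interpolation\<close> for
  \<open>u = x / y\<close> and \<open>v = z / y\<close>, replacing each \<open>y ^ j\<close> by \<open>l * x ^ j + m * z ^ j\<close> raises
  it where the coefficient is nonnegative and lowers it where the coefficient is nonpositive. No
  term of the polynomial decreases, that is, \<open>F y \<le> l * F x + m * F z\<close>.
  Allowing equality at one of the end points covers the case where \<open>x\<close> or \<open>z\<close> is a root.
\<close>

lemma two_sign_changes_neg_between:
  fixes d :: "nat \<Rightarrow> real" and F :: "real \<Rightarrow> real"
  assumes F: "\<And>s. F s = (\<Sum>j\<le>k. d j * s ^ j)"
    and pq: "p < q"
    and low: "\<And>j. j \<le> p \<Longrightarrow> 0 \<le> d j"
    and mid: "\<And>j. p < j \<Longrightarrow> j < q \<Longrightarrow> d j \<le> 0"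
    and high: "\<And>j. q \<le> j \<Longrightarrow> j \<le> k \<Longrightarrow> 0 \<le> d j"
    and xyz: "0 < x" "x < y" "y < z"
    and le: "F x \<le> 0" "F z \<le> 0" and less: "F x < 0 \<or> F z < 0"
  shows "F y < 0"
proof -
  define u v where "u = x / y" and "v = z / y"
  have uv: "0 < u" "u < 1" "1 < v" using xyz by (auto simp: u_def v_def)
  obtain l m where lm: "0 < l" "0 < m"
    and i1: "\<And>j. p \<le> j \<Longrightarrow> j \<le> q \<Longrightarrow> l * u ^ j + m * v ^ j \<le> 1"
    and i2: "\<And>j. j \<le> p \<Longrightarrow> 1 \<le> l * u ^ j + m * v ^ j"
    and i3: "\<And>j. q \<le> j \<Longrightarrow> 1 \<le> l * u ^ j + m * v ^ j"
    using power_interpolation[OF uv pq] by metis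
  have "d j \<le> d j * (l * u ^ j + m * v ^ j)" if "j \<le> k" for j
  proof -
    consider "j \<le> p" | "p < j" "j < q" | "q \<le> j" by linarith
    thus ?thesis
    proof cases
      case 1 thus ?thesis using low[of j] i2[of j] mult_left_mono[of 1 _ "d j"] by simp
    next
      case 2 thus ?thesis using mid[of j] i1[of j] mult_left_mono_neg[of _ 1 "d j"] by simp
    next
      case 3 thus ?thesis using high[of j] that i3[of j] mult_left_mono[of 1 _ "d j"] by simp
    qed
  qed
  hence "d j * y ^ j \<le> d j * (l * u ^ j + m * v ^ j) * y ^ j" if "j \<le> k" for j
    using that xyz by (intro mult_right_mono) auto
  moreover have "d j * (l * u ^ j + m * v ^ j) * y ^ j = l * (d j * x ^ j) + m * (d j * z ^ j)" for j
    using xyz by (simp add: u_def v_def power_divide field_simps)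
  ultimately have "F y \<le> (\<Sum>j\<le>k. l * (d j * x ^ j) + m * (d j * z ^ j))"
    unfolding F by (intro sum_mono) auto
  also have "\<dots> = l * F x + m * F z"
    by (simp add: F sum.distrib sum_distrib_left)
  also have "\<dots> < 0"
    using lm le less mult_pos_neg[of l "F x"] mult_pos_neg[of m "F z"]
      mult_nonneg_nonpos[of l "F x"] mult_nonneg_nonpos[of m "F z"] by linarith
  finally show ?thesis .
qed

section \<open>Truncated exponential series\<close>

text \<open>
  The parameter counts terms, so that \<open>exp_trunc 0 = 0\<close>. With this convention the coefficients of
  \<open>exp_trunc k (x + y)\<close> in powers of \<open>y\<close> follow one formula up to \<open>j = k\<close>.
\<close>

definition exp_trunc :: "nat \<Rightarrow> real \<Rightarrow> real" where
  "exp_trunc m x = (\<Sum>i<m. x ^ i / fact i)"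

lemma exp_trunc_0 [simp]: "exp_trunc 0 x = 0"
  and exp_trunc_Suc: "exp_trunc (Suc m) x = exp_trunc m x + x ^ m / fact m"
  by (simp_all add: exp_trunc_def)

lemma exp_trunc_add:
  "exp_trunc k (x + y) = (\<Sum>j\<le>k. exp_trunc (k - j) x / fact j * y ^ j)"
proof (induction k)
  case (Suc k)
  have "(\<Sum>j\<le>Suc k. exp_trunc (Suc k - j) x / fact j * y ^ j)
      = (\<Sum>j\<le>k. exp_trunc (k - j) x / fact j * y ^ j + y ^ j * x ^ (k - j) / (fact j * fact (k - j)))"
    by (simp add: Suc_diff_le exp_trunc_Suc field_simps)
  also have "\<dots> = exp_trunc k (x + y) + (\<Sum>j\<le>k. y ^ j * x ^ (k - j) / (fact j * fact (k - j)))"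
    by (simp add: sum.distrib Suc.IH)
  also have "(\<Sum>j\<le>k. y ^ j * x ^ (k - j) / (fact j * fact (k - j))) = (y + x) ^ k / fact k"
    unfolding binomial_ring sum_divide_distrib
    by (intro sum.cong refl) (simp add: binomial_fact field_simps)
  finally show ?case by (simp add: exp_trunc_Suc add.commute)
qed simp

text \<open>
  Both bounds come from the Lagrange form of the remainder, \<open>exp t * x ^ m / m!\<close>
  with \<open>t \<le> x\<close>.
\<close>

lemma exp_trunc_bounds:
  assumes "0 \<le> x"
  shows "exp_trunc m x \<le> exp x" and "exp x * (1 - x ^ m / fact m) \<le> exp_trunc m x"
proof -
  obtain t where t: "\<bar>t\<bar> \<le> \<bar>x\<bar>" and eq: "exp x = exp_trunc m x + exp t / fact m * x ^ m"
    using Maclaurin_exp_le[of x m] by (auto simp: exp_trunc_def)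
  have "0 \<le> exp t / fact m * x ^ m" using assms by simp
  with eq show "exp_trunc m x \<le> exp x" by linarith
  have "exp t \<le> exp x" using t assms by simp
  hence "exp t / fact m * x ^ m \<le> exp x / fact m * x ^ m"
    using assms by (intro mult_right_mono divide_right_mono) auto
  with eq show "exp x * (1 - x ^ m / fact m) \<le> exp_trunc m x" by (simp add: right_diff_distrib)
qed

section \<open>The two sides as a polynomial\<close>

definition gap :: "nat \<Rightarrow> real \<Rightarrow> real" where
  "gap k s = (1 + s / real k) ^ k - exp (-1/2) * exp_trunc k (1/2 + s)"

definition gap_coeff :: "nat \<Rightarrow> nat \<Rightarrow> real" where
  "gap_coeff k j = real (k choose j) / real k ^ j - exp (-1/2) * exp_trunc (k - j) (1/2) / fact j"

lemma gap_poly: "gap k s = (\<Sum>j\<le>k. gap_coeff k j * s ^ j)"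
proof -
  have "(1 + s / real k) ^ k = (\<Sum>j\<le>k. real (k choose j) / real k ^ j * s ^ j)"
    using binomial_ring[of "s / real k" 1 k] by (simp add: power_divide add.commute)
  moreover have "exp (-1/2) * exp_trunc k (1/2 + s)
      = (\<Sum>j\<le>k. exp (-1/2) * exp_trunc (k - j) (1/2) / fact j * s ^ j)"
    by (simp add: exp_trunc_add sum_distrib_left mult.assoc)
  ultimately show ?thesis
    by (simp add: gap_def gap_coeff_def sum_subtractf left_diff_distrib)
qed

lemma exp_half_mult: "exp (-1/2) * exp (1/2) = (1::real)"
  by (simp flip: exp_add)

text \<open>
  The left side is the product of the factors \<open>1 - i / k\<close> for \<open>i < j\<close>; the bound keeps only the
  last and smallest of them.
\<close>

lemma scaled_binomial_le:
  assumes j: "2 \<le> j" and jk: "j \<le> k"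
  shows "real (k choose j) * fact j / real k ^ j \<le> 1 - real (j - 1) / real k"
proof -
  obtain i where i: "j = Suc i" using j by (cases j) auto
  have "(k choose j) * fact j = (k - i) * ((k choose i) * fact i)"
    using binomial_absorb_comp[of k i] Suc_times_binomial_eq[of "k-1" i] jk
    by (cases k) (auto simp: i binomial_absorption algebra_simps)
  also have "\<dots> \<le> (k - i) * k ^ i"
    by (intro mult_left_mono binomial_fact_pow) auto
  finally have "real ((k choose j) * fact j) \<le> real ((k - i) * k ^ i)"
    using of_nat_le_iff by blast
  hence "real ((k choose j) * fact j) / real k ^ j \<le> real ((k - i) * k ^ i) / real k ^ j"
    by (intro divide_right_mono) auto
  also have "\<dots> = 1 - real (j - 1) / real k"
    using j jk by (simp add: i field_simps of_nat_diff)
  finally show ?thesis by simp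
qed

text \<open>
  With \<open>k = m + j\<close> this says that the relative truncation error \<open>(1/2) ^ m / m!\<close> at \<open>1/2\<close> is at most
  \<open>(j - 1) / k\<close>, the loss granted by \<open>scaled_binomial_le\<close>. It fails for \<open>m = 1\<close>, \<open>j = 2\<close>,
  and this is where \<open>k \<ge> 4\<close> enters.
\<close>

lemma fact_pow2_bound:
  assumes j: "2 \<le> j" and m: "1 \<le> m" and jm: "4 \<le> m + j"
  shows "m + j \<le> (j - 1) * (2 ^ m * fact m)"
proof (cases "m = 1")
  case False
  hence m2: "2 \<le> m" using m by simp
  have "m + 2 \<le> 2 * m" using m2 by simp
  also have "\<dots> \<le> 2 ^ m * fact m"
    using fact_ge_self[of m] power_increasing[of 1 m "2::nat"] m2 by (intro mult_mono) auto
  finally have "(j - 1) * (m + 2) \<le> (j - 1) * (2 ^ m * fact m)" by (intro mult_left_mono) auto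
  moreover have "m + j \<le> (j - 1) * (m + 2)"
    using j by (cases j; cases "j - 1") (auto simp: algebra_simps)
  ultimately show ?thesis by linarith
qed (use jm in auto)

lemma gap_coeff_signs:
  assumes k: "4 \<le> k"
  shows "j \<le> 1 \<Longrightarrow> 0 \<le> gap_coeff k j"
    and "1 < j \<Longrightarrow> j < k \<Longrightarrow> gap_coeff k j \<le> 0"
    and "k \<le> j \<Longrightarrow> 0 \<le> gap_coeff k j"
proof -
  have le1: "exp (-1/2) * exp_trunc m (1/2) \<le> 1" for m
  proof -
    have "exp (-1/2) * exp_trunc m (1/2) \<le> exp (-1/2) * exp (1/2)"
      by (intro mult_left_mono exp_trunc_bounds) auto
    thus ?thesis unfolding exp_half_mult .
  qed
  show "0 \<le> gap_coeff k j" if "j \<le> 1"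
    using that le1[of "k - j"] k by (cases j) (auto simp: gap_coeff_def)
  show "gap_coeff k j \<le> 0" if j: "1 < j" "j < k"
  proof -
    define m where "m = k - j"
    have m: "1 \<le> m" "k = m + j" using j by (auto simp: m_def)
    have "real (m + j) \<le> real ((j - 1) * (2 ^ m * fact m))"
      by (intro of_nat_mono fact_pow2_bound) (use m j k in auto)
    hence "(1/2) ^ m / fact m \<le> real (j - 1) / real k"
      using m j by (simp add: field_simps)
    moreover have "1 - (1/2) ^ m / fact m \<le> exp (-1/2) * exp_trunc m (1/2)"
    proof -
      have "exp (-1/2) * (exp (1/2) * (1 - (1/2) ^ m / fact m)) \<le> exp (-1/2) * exp_trunc m (1/2)"
        by (intro mult_left_mono exp_trunc_bounds) auto
      thus ?thesis unfolding mult.assoc[symmetric] exp_half_mult by simp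
    qed
    moreover have "real (k choose j) * fact j / real k ^ j \<le> 1 - real (j - 1) / real k"
      using j by (intro scaled_binomial_le) auto
    ultimately have "real (k choose j) * fact j / real k ^ j \<le> exp (-1/2) * exp_trunc m (1/2)"
      by linarith
    from divide_right_mono[OF this, of "fact j"] show ?thesis
      by (simp add: gap_coeff_def m_def)
  qed
  show "0 \<le> gap_coeff k j" if "k \<le> j"
    using that by (simp add: gap_coeff_def)
qed

lemma gap_neg_between:
  assumes "4 \<le> k" "0 < x" "x < y" "y < z" "gap k x \<le> 0" "gap k z \<le> 0" "gap k x < 0 \<or> gap k z < 0"
  shows "gap k y < 0"
  by (rule two_sign_changes_neg_between[OF gap_poly, of 1 k _ x y z])
    (use assms gap_coeff_signs[of k] in auto)

section \<open>Sign of the difference at particular points\<close>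

lemma gap_0_pos: "0 < gap k 0"
proof -
  have "exp_trunc k (1/2) < exp_trunc (Suc k) (1/2)" by (simp add: exp_trunc_Suc)
  also have "\<dots> \<le> exp (1/2)" by (intro exp_trunc_bounds) auto
  finally have "exp (-1/2) * exp_trunc k (1/2) < exp (-1/2) * exp (1/2)" by simp
  thus ?thesis unfolding exp_half_mult by (simp add: gap_def)
qed

lemma one_plus_le_exp_quadratic:
  fixes y :: real
  assumes "0 \<le> y" "y \<le> 1"
  shows "1 + y \<le> exp (y - y\<^sup>2 / 4)"
proof -
  have eq: "y - y\<^sup>2 / 4 = y * (1 - y / 4)" by (simp add: power2_eq_square algebra_simps)
  have "(3/4)\<^sup>2 \<le> (1 - y / 4)\<^sup>2" using assms by (intro power_mono) auto
  hence "y\<^sup>2 * (1/2) \<le> y\<^sup>2 * (1 - y / 4)\<^sup>2" by (intro mult_left_mono) (auto simp: power2_eq_square)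
  hence "1 + y \<le> 1 + (y - y\<^sup>2 / 4) + (y - y\<^sup>2 / 4)\<^sup>2 / 2"
    by (simp add: eq power_mult_distrib) (simp add: algebra_simps power2_eq_square)
  also have "\<dots> \<le> exp (y - y\<^sup>2 / 4)"
    using assms by (intro exp_lower_Taylor_quadratic) (simp add: eq)
  finally show ?thesis .
qed

text \<open>
  With \<open>w = s\<^sup>2 / (4 k)\<close>, the left side is at most \<open>exp (s - w) \<le> exp s / (1 + w)\<close>, and the right side
  is at least \<open>exp s * (1 - (1/2 + s) ^ k / k!)\<close>. The assumption says that the relative
  loss \<open>w / (1 + w)\<close> of the first exceeds the relative loss of the second.
\<close>

lemma gap_neg_criterion:
  assumes s: "0 < s" "s \<le> real k"
    and small: "(1/2 + s) ^ k / fact k < s\<^sup>2 / (4 * real k + s\<^sup>2)"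
  shows "gap k s < 0"
proof -
  have k: "real k > 0" using s by simp
  define w where "w = s\<^sup>2 / (4 * real k)"
  have w: "w > 0" using s k by (simp add: w_def)
  have "(1 + s / real k) ^ k \<le> exp (s / real k - (s / real k)\<^sup>2 / 4) ^ k"
    using s k by (intro power_mono one_plus_le_exp_quadratic) auto
  also have "\<dots> = exp (s - w)"
    using k by (simp add: w_def power2_eq_square field_simps flip: exp_of_nat_mult)
  also have "\<dots> = exp s / exp w" by (rule exp_diff)
  also have "\<dots> \<le> exp s / (1 + w)"
    using w exp_ge_add_one_self[of w] by (intro divide_left_mono) auto
  also have "\<dots> = exp s * (1 - s\<^sup>2 / (4 * real k + s\<^sup>2))"
  proof -
    have "4 * real k + s\<^sup>2 > 0" using k by (simp add: add_pos_nonneg)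
    thus ?thesis using k w by (simp add: w_def field_simps)
  qed
  also have "\<dots> < exp s * (1 - (1/2 + s) ^ k / fact k)"
    using small by simp
  also have "exp s = exp (-1/2) * exp (1/2 + s)" by (simp flip: exp_add)
  also have "exp (-1/2) * exp (1/2 + s) * (1 - (1/2 + s) ^ k / fact k)
      \<le> exp (-1/2) * exp_trunc k (1/2 + s)"
    using exp_trunc_bounds(2)[of "1/2 + s" k] s by (simp add: mult.assoc)
  finally show ?thesis by (simp add: gap_def)
qed

text \<open>
  At \<open>s = 1/2\<close> the criterion reads \<open>16 k + 1 < k!\<close>, which holds from \<open>k = 5\<close> on. For \<open>k = 4\<close> the
  values are close (about \<open>1.602\<close> and \<open>1.617\<close>) and a numerical bound on \<open>exp 1\<close> decides.
\<close>

lemma gap_half_neg: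
  assumes k: "4 \<le> k"
  shows "gap k (1/2) < 0"
proof (cases "k = 4")
  case True
  have "exp (1/2 :: real) < 1.65"
  proof (rule power_less_imp_less_base)
    show "exp (1/2 :: real) ^ 2 < 1.65 ^ 2"
      using e_less_272 by (simp add: power2_eq_square flip: exp_add)
  qed simp
  hence "(1 + 1 / 8 :: real) ^ 4 * exp (1/2) < 8/3"
    by (simp add: power4_eq_xxxx field_simps)
  hence "exp (-1/2) * ((1 + 1 / 8 :: real) ^ 4 * exp (1/2)) < exp (-1/2) * (8/3)" by simp
  also have "exp (-1/2) * ((1 + 1 / 8 :: real) ^ 4 * exp (1/2))
      = (1 + 1 / 8) ^ 4 * (exp (-1/2) * exp (1/2))" by (simp only: mult_ac)
  finally have "(1 + 1 / 8 :: real) ^ 4 < exp (-1/2) * (8/3)"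
    unfolding exp_half_mult by simp
  thus ?thesis by (simp add: True gap_def exp_trunc_def eval_nat_numeral)
next
  case False
  hence "Suc 4 \<le> k" using k by simp
  hence "16 * k + 1 < fact k"
  proof (induction k rule: dec_induct)
    case (step n)
    have "16 * Suc n + 1 \<le> 2 * (16 * n + 1)" using step by simp
    also have "\<dots> < 2 * fact n" using step by simp
    also have "\<dots> \<le> Suc n * fact n" using step by (intro mult_right_mono) auto
    finally show ?case by simp
  qed (simp add: fact_numeral)
  hence "real (16 * k + 1) < real (fact k)" using of_nat_less_iff by blast
  hence "1 / fact k < 1 / real (16 * k + 1)"
    by (intro divide_strict_left_mono) auto
  thus ?thesis using k by (intro gap_neg_criterion) (auto simp: field_simps)
qed

lemma gap_eventually_neg:
  assumes s: "0 < s"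
  shows "eventually (\<lambda>k. gap k s < 0) sequentially"
proof -
  define X where "X = 1/2 + s"
  have "(\<lambda>n. X ^ n / fact n) \<longlonglongrightarrow> 0"
    using summable_LIMSEQ_zero[OF summable_exp[of X]] by (simp add: field_simps)
  hence "(\<lambda>n. X * (X ^ n / fact n)) \<longlonglongrightarrow> X * 0" by (intro tendsto_intros)
  hence "eventually (\<lambda>n. X * (X ^ n / fact n) < s\<^sup>2 / (4 + s\<^sup>2)) sequentially"
    using s by (intro order_tendstoD(2)) (auto simp: add_pos_nonneg)
  hence "eventually (\<lambda>n. gap (Suc n) s < 0) sequentially"
    using eventually_ge_at_top[of "nat \<lceil>s\<rceil>"]
  proof eventually_elim
    case (elim n)
    have pos: "4 + s\<^sup>2 > 0" "4 * real (Suc n) + s\<^sup>2 > 0" by (auto simp: add_pos_nonneg)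
    have "X ^ Suc n / fact (Suc n) = X * (X ^ n / fact n) / real (Suc n)"
      by (simp add: field_simps)
    also have "\<dots> < s\<^sup>2 / (4 + s\<^sup>2) / real (Suc n)"
      using elim by (intro divide_strict_right_mono) auto
    also have "\<dots> \<le> s\<^sup>2 / (4 * real (Suc n) + s\<^sup>2)"
      unfolding divide_divide_eq_left
    proof (intro divide_left_mono mult_pos_pos pos)
      show "4 * real (Suc n) + s\<^sup>2 \<le> (4 + s\<^sup>2) * real (Suc n)" by (simp add: algebra_simps)
    qed auto
    finally show ?case
      using elim s by (intro gap_neg_criterion) (auto simp: X_def nat_ceiling_le_eq)
  qed
  thus ?thesis by (subst (asm) eventually_sequentially_Suc)
qed

text \<open>
  The witness is so large that \<open>(s / k) ^ k\<close> alone dominates \<open>k\<close> copies of \<open>(2 s) ^ (k - 1)\<close>, each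
  of which bounds a term of \<open>exp_trunc k (1/2 + s)\<close>.
\<close>

lemma gap_nonneg_large:
  assumes k: "1 \<le> k"
  obtains s where "1/2 < s" "0 \<le> gap k s"
proof
  define s where "s = real k ^ Suc k * 2 ^ k"
  have "1 * 2 ^ 1 \<le> s"
    unfolding s_def using k by (intro mult_mono power_increasing one_le_power) auto
  thus s: "1/2 < s" by simp
  have "exp_trunc k (1/2 + s) \<le> (\<Sum>i<k. (2 * s) ^ (k - 1))"
    unfolding exp_trunc_def
  proof (intro sum_mono)
    fix i assume "i \<in> {..<k}"
    have "(1/2 + s) ^ i / fact i \<le> (1/2 + s) ^ i / 1"
      using s by (intro divide_left_mono) auto
    also have "\<dots> \<le> (2 * s) ^ i" unfolding div_by_1 using s by (intro power_mono) auto
    also have "\<dots> \<le> (2 * s) ^ (k - 1)"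
      using s \<open>i \<in> {..<k}\<close> by (intro power_increasing) auto
    finally show "(1/2 + s) ^ i / fact i \<le> (2 * s) ^ (k - 1)" .
  qed
  also have "\<dots> = real k * 2 ^ (k - 1) * s ^ (k - 1)" by (simp add: power_mult_distrib)
  also have "\<dots> \<le> real k * 2 ^ k * s ^ (k - 1)"
    using s by (intro mult_right_mono mult_left_mono power_increasing) auto
  also have "\<dots> = (s / real k) ^ k"
  proof -
    have "s ^ k = s * s ^ (k - 1)" using k by (cases k) auto
    thus ?thesis using k by (simp add: power_divide field_simps) (simp add: s_def algebra_simps)
  qed
  also have "\<dots> \<le> (1 + s / real k) ^ k" using s by (intro power_mono) auto
  finally have "exp_trunc k (1/2 + s) \<le> (1 + s / real k) ^ k" .
  moreover have "exp (-1/2) * exp_trunc k (1/2 + s) \<le> 1 * exp_trunc k (1/2 + s)"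
    using s by (intro mult_right_mono) (auto simp: exp_trunc_def intro!: sum_nonneg)
  ultimately show "0 \<le> gap k s" by (simp add: gap_def)
qed

section \<open>The thresholds\<close>

lemma thresholds_iff_gap:
  assumes k: "1 \<le> k"
  shows "thresholds (2 * k) a b \<longleftrightarrow>
    0 < a \<and> a < 1 \<and> 1 < b \<and> (\<forall>r>0. gap k (r / 2) < 0 \<longleftrightarrow> a < r \<and> r < b)"
proof -
  have "{0..k - 1} = {..<k}" using k by auto
  moreover have "(1 + r) ^ i / (2 ^ i * fact i) = (1/2 + r/2) ^ i / fact i" for r :: real and i
    by (simp add: power_divide flip: add_divide_distrib)
  moreover have "1 / sqrt (exp 1) = exp (-1/2)"
  proof -
    have "sqrt (exp 1) = exp (1/2)"
      by (intro real_sqrt_unique) (auto simp: power2_eq_square simp flip: exp_add)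
    thus ?thesis by (simp add: exp_minus field_simps)
  qed
  ultimately show ?thesis
    by (simp add: thresholds_def gap_def exp_trunc_def)
qed

lemma thresholds_exist:
  assumes k: "4 \<le> k"
  shows "\<exists>a b. thresholds (2 * k) a b"
proof -
  have half: "gap k (1/2) < 0" by (rule gap_half_neg[OF k])
  have cont: "continuous_on S (gap k)" for S
    unfolding gap_poly[abs_def] by (intro continuous_intros)
  obtain a where a: "0 \<le> a" "a \<le> 1/2" "gap k a = 0"
    using IVT2'[of "gap k" "1/2" 0 0] half gap_0_pos[of k] cont by auto
  have a': "0 < a" "a < 1/2"
    using a half gap_0_pos[of k] by (metis less_le)+
  obtain s where s: "1/2 < s" "0 \<le> gap k s" using gap_nonneg_large[of k] k by auto
  obtain b where b: "1/2 \<le> b" "gap k b = 0"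
    using IVT'[of "gap k" "1/2" 0 s] half s cont by auto
  have b': "1/2 < b" using b half by (metis less_le)
  have "gap k t < 0 \<longleftrightarrow> a < t \<and> t < b" if t: "0 < t" for t
  proof
    assume "a < t \<and> t < b"
    then consider "a < t" "t < 1/2" | "t = 1/2" | "1/2 < t" "t < b" by linarith
    thus "gap k t < 0"
    proof cases
      case 1 thus ?thesis using gap_neg_between[OF k, of a t "1/2"] half a a' by simp
    next
      case 2 thus ?thesis using half by (simp only:)
    next
      case 3 thus ?thesis using gap_neg_between[OF k, of "1/2" t b] half b by simp
    qed
  next
    \<comment> \<open>If \<open>t < a\<close>, then the root \<open>a\<close> would lie between the points \<open>t\<close> and \<open>1/2\<close>, where \<open>gap k\<close> is
      negative; likewise for \<open>b < t\<close>.\<close>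
    assume neg: "gap k t < 0"
    have "\<not> t < a" using gap_neg_between[OF k, of t a "1/2"] neg half a a' t by auto
    moreover have "\<not> b < t" using gap_neg_between[OF k, of "1/2" b t] neg half b b' by auto
    moreover have "t \<noteq> a" "t \<noteq> b" using neg a b by auto
    ultimately show "a < t \<and> t < b" by linarith
  qed
  \<comment> \<open>The roots are in terms of \<open>s = r / 2\<close>, so the thresholds are their doubles.\<close>
  from this[of "r / 2" for r] have "thresholds (2 * k) (2 * a) (2 * b)"
    using k a' b' by (subst thresholds_iff_gap) auto
  thus ?thesis by blast
qed

lemma thresholds_unique:
  assumes "thresholds n a b" "thresholds n a' b'"
  shows "a = a' \<and> b = b'"
proof -
  have "0 < a" "a < b" "0 < a'" "a' < b'"
    and "\<forall>r>0. (a < r \<and> r < b) = (a' < r \<and> r < b')"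
    using assms unfolding thresholds_def by auto
  hence "{a<..<b} = {a'<..<b'}"
    by (intro set_eqI) (smt (verit) greaterThanLessThan_iff)
  thus ?thesis using \<open>a < b\<close> by (auto simp: greaterThanLessThan_eq_iff)
qed

theorem mainTheorem9:
  shows "(\<forall>n. even n \<and> n \<ge> 8 \<longrightarrow> (\<exists>!p. thresholds n (fst p) (snd p))) \<and>
         (\<forall>r r' :: nat \<Rightarrow> real.
            (\<forall>n. even n \<and> n \<ge> 8 \<longrightarrow> thresholds n (r n) (r' n)) \<longrightarrow>
            ((\<lambda>m. r (2 * m)) \<longlonglongrightarrow> 0) \<and>
            filterlim (\<lambda>m. r' (2 * m)) at_top sequentially)"
proof (intro conjI allI impI)
  fix n :: nat assume n: "even n \<and> n \<ge> 8"
  then obtain k where k: "n = 2 * k" "4 \<le> k" by (auto elim!: evenE)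
  obtain a b where "thresholds n a b" using thresholds_exist[of k] k by auto
  thus "\<exists>!p. thresholds n (fst p) (snd p)"
    by (intro ex1I[of _ "(a, b)"]) (auto simp: prod_eq_iff dest: thresholds_unique)
next
  fix r r' :: "nat \<Rightarrow> real"
  assume thr: "\<forall>n. even n \<and> n \<ge> 8 \<longrightarrow> thresholds n (r n) (r' n)"
  have between: "eventually (\<lambda>m. 0 < r (2 * m) \<and> r (2 * m) < x \<and> x < r' (2 * m)) sequentially"
    if "0 < x" for x
  proof -
    have "eventually (\<lambda>m. gap m (x / 2) < 0) sequentially"
      using that by (intro gap_eventually_neg) auto
    thus ?thesis using eventually_ge_at_top[of 4]
    proof eventually_elim
      case (elim m)
      have "thresholds (2 * m) (r (2 * m)) (r' (2 * m))" using thr elim by auto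
      thus ?case using elim that by (subst (asm) thresholds_iff_gap) auto
    qed
  qed
  show "(\<lambda>m. r (2 * m)) \<longlonglongrightarrow> 0"
  proof (rule order_tendstoI)
    fix y :: real
    show "eventually (\<lambda>m. y < r (2 * m)) sequentially" if "y < 0"
      using between[of 1] that by (auto elim: eventually_mono)
    show "eventually (\<lambda>m. r (2 * m) < y) sequentially" if "0 < y"
      using between[of y] that by (auto elim: eventually_mono)
  qed
  show "filterlim (\<lambda>m. r' (2 * m)) at_top sequentially"
    unfolding filterlim_at_top
  proof
    fix Z :: real
    show "eventually (\<lambda>m. Z \<le> r' (2 * m)) sequentially"
      using between[of "max 1 Z", simplified] by (rule eventually_mono) auto
  qed
qed

end
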